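(* Let $\Gamma$ be a metrized graph with an edge $e_i$ such that $\Gamma-e_i$ is connected. Then $$x(\Gamma)=\frac{L_iR_i}{L_i+R_i}+\frac{L_i}{L_i+R_i}x(\Gamma-e_i)+\frac{R_i}{L_i+R_i}x(\overline{\Gamma}_i),\qquad y(\Gamma)=\frac{L_i}{L_i+R_i}y(\Gamma-e_i)+\frac{R_i}{L_i+R_i}y(\overline{\Gamma}_i).$$
   Context: A metrized graph is a finite connected graph (multiple edges and self-loops allowed) whose edges $e_j$ are identified with closed segments of lengths $L_j>0$; its vertex set is finite, nonempty, and contains all points of valence $\neq2$. View a metrized graph $G$ as an electric circuit with edge resistances equal to lengths; the voltage function $j_z(x,y)$ is the voltage at $x$ (reference $0$ at $z$) when unit current enters at $y$ and exits at $z$. For an edge $e_j$ of $G$ with endpoints $p_j,q_j$, $G-e_j$ is $G$ with the interior of $e_j$ removed, $R_j$ is the effective resistance between $p_j,q_j$ in $G-e_j$, and for a fixed vertex $p$, with $\hat j$ the voltage function of $G-e_j$, $R_{a_j,p}=\hat j_{p_j}(p,q_j)$, $R_{b_j,p}=\hat j_{q_j}(p_j,p)$. Define $y(G)=\frac14\sum_{e_j}\frac{L_jR_j^2}{(L_j+R_j)^2}+\frac34\sum_{e_j}\frac{L_j(R_{a_j,p}-R_{b_j,p})^2}{(L_j+R_j)^2}$, $x(G)=\sum_{e_j}\frac{L_j^2R_j}{(L_j+R_j)^2}+\frac34\sum_{e_j}\frac{L_jR_j^2}{(L_j+R_j)^2}-\frac34\sum_{e_j}\frac{L_j(R_{a_j,p}-R_{b_j,p})^2}{(L_j+R_j)^2}$.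 If $e_j$ is a bridge of $G$ ($R_j=\infty$), then $(R_{a_j,p}-R_{b_j,p})^2=R_j^2$ and each summand is replaced by its limit as $R_j\to\infty$. $\overline{\Gamma}_i$ is obtained from $\Gamma$ by contracting $e_i$ to a point; $R_i$ refers to $\Gamma$. *)

theory Defs
  imports Complex_Main "Graph_Theory.Digraph_Component"
begin

text \<open>
  A metrized graph with a chosen vertex set is a finite connected multigraph, self-loops and
  parallel edges allowed, together with edge lengths.  The multigraph is a \<open>pre_digraph\<close>, in which
  the direction of an arc only serves to name the endpoints: \<open>tail G e\<close> is \<open>p\<^sub>e\<close> and \<open>head G e\<close> is
  \<open>q\<^sub>e\<close>.  Connectedness is that of the underlying undirected graph, and includes that there is a
  vertex.  Interior points of segments have valence 2, so every point of valence other than 2 is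
  automatically a vertex.
\<close>

locale metrized_graph = fin_digraph G for G :: "('v, 'e) pre_digraph" +
  fixes L :: "'e \<Rightarrow> real"
  assumes connected_graph: "Digraph_Component.connected G"
    and length_pos: "e \<in> arcs G \<Longrightarrow> 0 < L e"

abbreviation delete_edge :: "('v, 'e) pre_digraph \<Rightarrow> 'e \<Rightarrow> ('v, 'e) pre_digraph" where
  "delete_edge G e \<equiv> pre_digraph.del_arc G e"

text \<open>
  The endpoint \<open>tail G e\<close> serves as the point to which \<open>e\<close> is contracted; the other edges survive,
  those parallel to \<open>e\<close> as self-loops.
\<close>

definition contract_edge :: "('v, 'e) pre_digraph \<Rightarrow> 'e \<Rightarrow> ('v, 'e) pre_digraph" where
  "contract_edge G e =
     (let \<pi> = (\<lambda>v. if v = head G e then tail G e else v)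
      in \<lparr> verts = \<pi> ` verts G, arcs = arcs G - {e}, tail = \<pi> \<circ> tail G, head = \<pi> \<circ> head G \<rparr>)"

text \<open>
  Ohm's law: the current through \<open>e\<close> from \<open>tail G e\<close> to \<open>head G e\<close> when the vertices have
  voltages \<open>f\<close>.
\<close>

definition current :: "('v, 'e) pre_digraph \<Rightarrow> ('e \<Rightarrow> real) \<Rightarrow> ('v \<Rightarrow> real) \<Rightarrow> 'e \<Rightarrow> real" where
  "current G L f e = (f (tail G e) - f (head G e)) / L e"

text \<open>
  Kirchhoff's current law when unit current enters at \<open>y\<close> and exits at \<open>z\<close>, where \<open>z\<close> has
  reference voltage 0.  If \<open>y = z\<close>, no net current is injected.
\<close>

definition is_voltage ::
    "('v, 'e) pre_digraph \<Rightarrow> ('e \<Rightarrow> real) \<Rightarrow> 'v \<Rightarrow> 'v \<Rightarrow> ('v \<Rightarrow> real) \<Rightarrow> bool" where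
  "is_voltage G L z y f \<longleftrightarrow>
     f z = 0 \<and>
     (\<forall>v \<in> verts G.
        (\<Sum>e\<in>out_arcs G v. current G L f e) - (\<Sum>e\<in>in_arcs G v. current G L f e)
        = (if v = y then 1 else 0) - (if v = z then 1 else 0))"

text \<open>
  \<open>voltage G L z x y\<close> is \<open>j\<^sub>z(x,y)\<close>, used only for vertices \<open>x, y, z\<close> of a connected \<open>G\<close>, where
  Kirchhoff's equations determine the voltage at each vertex.
\<close>

definition voltage :: "('v, 'e) pre_digraph \<Rightarrow> ('e \<Rightarrow> real) \<Rightarrow> 'v \<Rightarrow> 'v \<Rightarrow> 'v \<Rightarrow> real" where
  "voltage G L z x y = (THE c. \<exists>f. is_voltage G L z y f \<and> f x = c)"

definition eff_res :: "('v, 'e) pre_digraph \<Rightarrow> ('e \<Rightarrow> real) \<Rightarrow> 'v \<Rightarrow> 'v \<Rightarrow> real" where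
  "eff_res G L x y = voltage G L y x x"

definition bridge :: "('v, 'e) pre_digraph \<Rightarrow> 'e \<Rightarrow> bool" where
  "bridge G e \<longleftrightarrow> \<not> Digraph_Component.connected (delete_edge G e)"

text \<open>
  \<open>R\<^sub>e\<close>, \<open>R\<^bsub>a,p\<^esub>\<close> and \<open>R\<^bsub>b,p\<^esub>\<close> of an edge \<open>e\<close> that is not a bridge; all three refer to \<open>G - e\<close>.
\<close>

definition edge_R :: "('v, 'e) pre_digraph \<Rightarrow> ('e \<Rightarrow> real) \<Rightarrow> 'e \<Rightarrow> real" where
  "edge_R G L e = eff_res (delete_edge G e) L (tail G e) (head G e)"

definition edge_Ra :: "('v, 'e) pre_digraph \<Rightarrow> ('e \<Rightarrow> real) \<Rightarrow> 'v \<Rightarrow> 'e \<Rightarrow> real" where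
  "edge_Ra G L p e = voltage (delete_edge G e) L (tail G e) p (head G e)"

definition edge_Rb :: "('v, 'e) pre_digraph \<Rightarrow> ('e \<Rightarrow> real) \<Rightarrow> 'v \<Rightarrow> 'e \<Rightarrow> real" where
  "edge_Rb G L p e = voltage (delete_edge G e) L (head G e) (tail G e) p"

text \<open>
  A summand is an expression \<open>F R D\<close> in \<open>R = R\<^sub>e\<close> and \<open>D = (R\<^bsub>a,p\<^esub> - R\<^bsub>b,p\<^esub>)\<^sup>2\<close>.  For a bridge \<open>D\<close> is
  \<open>R\<^sup>2\<close>, and the limit as \<open>R\<close> tends to infinity is taken.
\<close>

definition edge_term ::
    "('v, 'e) pre_digraph \<Rightarrow> ('e \<Rightarrow> real) \<Rightarrow> 'v \<Rightarrow> 'e \<Rightarrow> (real \<Rightarrow> real \<Rightarrow> real) \<Rightarrow> real" where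
  "edge_term G L p e F =
     (if bridge G e then Lim at_top (\<lambda>R. F R (R\<^sup>2))
      else F (edge_R G L e) ((edge_Ra G L p e - edge_Rb G L p e)\<^sup>2))"

definition y_inv :: "('v, 'e) pre_digraph \<Rightarrow> ('e \<Rightarrow> real) \<Rightarrow> 'v \<Rightarrow> real" where
  "y_inv G L p =
     1/4 * (\<Sum>e\<in>arcs G. edge_term G L p e (\<lambda>R D. L e * R\<^sup>2 / (L e + R)\<^sup>2))
   + 3/4 * (\<Sum>e\<in>arcs G. edge_term G L p e (\<lambda>R D. L e * D / (L e + R)\<^sup>2))"

definition x_inv :: "('v, 'e) pre_digraph \<Rightarrow> ('e \<Rightarrow> real) \<Rightarrow> 'v \<Rightarrow> real" where
  "x_inv G L p =
     (\<Sum>e\<in>arcs G. edge_term G L p e (\<lambda>R D. (L e)\<^sup>2 * R / (L e + R)\<^sup>2))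
   + 3/4 * (\<Sum>e\<in>arcs G. edge_term G L p e (\<lambda>R D. L e * R\<^sup>2 / (L e + R)\<^sup>2))
   - 3/4 * (\<Sum>e\<in>arcs G. edge_term G L p e (\<lambda>R D. L e * D / (L e + R)\<^sup>2))"

end

theory Submission
  imports Defs "HOL-Real_Asymp.Real_Asymp"
begin

text \<open>
  Write \<open>r(x, y)\<close> for effective resistance in \<open>G\<close>.  Every summand, also the limit at a bridge,
  can be expressed by \<open>r\<close> alone: with \<open>r\<^sub>e = r(p\<^sub>e, q\<^sub>e)\<close>,
  \<open>y(G) = \<Sum>\<^sub>e (r\<^sub>e\<^sup>2 + 3 (r(p\<^sub>e, p) - r(q\<^sub>e, p))\<^sup>2) / (4 L\<^sub>e)\<close> and \<open>x(G) + y(G) = \<Sum>\<^sub>e r\<^sub>e\<close>.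
  Now let \<open>\<phi>\<close> be the potential on \<open>G - e\<close> of a unit current between the ends of \<open>e\<close>, and
  \<open>R = R\<^sub>e\<close>.  Inserting \<open>e\<close> lowers the resistance between \<open>x\<close> and \<open>y\<close> by
  \<open>(\<phi> x - \<phi> y)\<^sup>2 / (L\<^sub>e + R)\<close>, contracting it lowers it by \<open>(\<phi> x - \<phi> y)\<^sup>2 / R\<close>.  Hence \<open>r\<close> is the
  convex combination of the resistances for deletion and contraction with weights
  \<open>L\<^sub>e / (L\<^sub>e + R)\<close> and \<open>R / (L\<^sub>e + R)\<close>.  For the quadratic \<open>y\<close> there remains a variance term,
  which at base point \<open>p\<^sub>e\<close> with \<open>\<phi> p\<^sub>e = 0\<close> is, up to a constant, the sum over the other edges of
  the current of \<open>\<phi>\<close> times the drop of \<open>\<phi>\<^sup>3\<close>; by Kirchhoff's law this is \<open>R\<^sup>3\<close>, and the term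
  cancels the summand of \<open>e\<close> itself.
\<close>

section \<open>Connectedness as constancy of functions that are equal at both ends of every
  arc\<close>

lemma (in wf_digraph) connected_constant:
  assumes "Digraph_Component.connected G"
    and P: "\<And>a. a \<in> arcs G \<Longrightarrow> P (tail G a) = P (head G a)"
    and "u \<in> verts G" "v \<in> verts G"
  shows "P u = P v"
proof -
  have "(u, v) \<in> rtrancl_on (verts G) ((arcs_ends G)\<^sup>s)"
    using assms unfolding connected_conv by blast
  then show ?thesis
  proof (induct rule: rtrancl_on_induct)
    case (step y z)
    then obtain a where "a \<in> arcs G" "(y, z) = (tail G a, head G a) \<or> (y, z) = (head G a, tail G a)"
      by (auto simp: symcl_def arcs_ends_def arc_to_ends_def)
    then have "P y = P z" using P[of a] by auto
    then show ?case using step by simp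
  qed simp
qed

text \<open>Reachability from a fixed vertex is itself such a predicate. In this form connectedness
  passes to contractions, and its failure directly supplies a cut.\<close>

lemma (in wf_digraph) connectedI:
  assumes "verts G \<noteq> {}"
    and const: "\<And>P :: 'a \<Rightarrow> bool. \<And>u v. (\<And>a. a \<in> arcs G \<Longrightarrow> P (tail G a) = P (head G a)) \<Longrightarrow>
      u \<in> verts G \<Longrightarrow> v \<in> verts G \<Longrightarrow> P u = P v"
  shows "Digraph_Component.connected G"
  unfolding connected_conv
proof (intro conjI ballI)
  fix u v assume uv: "u \<in> verts G" "v \<in> verts G"
  let ?P = "\<lambda>w. (u, w) \<in> rtrancl_on (verts G) ((arcs_ends G)\<^sup>s)"
  have "?P (tail G a) = ?P (head G a)" if a: "a \<in> arcs G" for a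
  proof -
    have "(tail G a, head G a) \<in> (arcs_ends G)\<^sup>s" "(head G a, tail G a) \<in> (arcs_ends G)\<^sup>s"
      using a by (auto simp: symcl_def arcs_ends_def arc_to_ends_def image_def)
    then show ?thesis
      using a by (meson head_in_verts rtrancl_on_into_rtrancl_on tail_in_verts)
  qed
  then have "?P u = ?P v" using uv by (rule const)
  then show "?P v" using uv(1) by simp
qed fact

section \<open>Potentials of dipoles\<close>

definition dipole :: "'v \<Rightarrow> 'v \<Rightarrow> 'v \<Rightarrow> real" where
  "dipole y z v = (if v = y then 1 else 0) - (if v = z then 1 else 0)"

definition net_current ::
    "('v, 'e) pre_digraph \<Rightarrow> ('e \<Rightarrow> real) \<Rightarrow> ('v \<Rightarrow> real) \<Rightarrow> 'v \<Rightarrow> real" where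
  "net_current G L f v =
     (\<Sum>a\<in>out_arcs G v. current G L f a) - (\<Sum>a\<in>in_arcs G v. current G L f a)"

text \<open>Unlike \<open>is_voltage\<close>, no reference voltage is fixed, so these functions can
  be added, negated and shifted. Only their differences matter.\<close>

definition dipole_potential ::
    "('v, 'e) pre_digraph \<Rightarrow> ('e \<Rightarrow> real) \<Rightarrow> 'v \<Rightarrow> 'v \<Rightarrow> ('v \<Rightarrow> real) \<Rightarrow> bool" where
  "dipole_potential G L y z f \<longleftrightarrow> (\<forall>v\<in>verts G. net_current G L f v = dipole y z v)"

text \<open>The Dirichlet form of the network; its diagonal is the dissipated power.\<close>

definition energy ::
    "('v, 'e) pre_digraph \<Rightarrow> ('e \<Rightarrow> real) \<Rightarrow> ('v \<Rightarrow> real) \<Rightarrow> ('v \<Rightarrow> real) \<Rightarrow> real" where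
  "energy G L f g = (\<Sum>a\<in>arcs G. current G L f a * (g (tail G a) - g (head G a)))"

lemma is_voltage_iff:
  "is_voltage G L z y f \<longleftrightarrow> f z = 0 \<and> dipole_potential G L y z f"
  by (simp add: is_voltage_def dipole_potential_def net_current_def dipole_def)

lemma current_linear:
  "current G L (\<lambda>v. f v + c * g v) a = current G L f a + c * current G L g a"
  by (simp add: current_def algebra_simps add_divide_distrib diff_divide_distrib)

lemma net_current_linear:
  "net_current G L (\<lambda>v. f v + c * g v) v = net_current G L f v + c * net_current G L g v"
  by (simp add: net_current_def current_linear sum.distrib sum_distrib_left[symmetric] algebra_simps)

lemma net_current_const [simp]: "net_current G L (\<lambda>_. c) v = 0"
  by (simp add: net_current_def current_def)

lemma dipole_potential_refl: "dipole_potential G L x x (\<lambda>_. 0)"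
  by (simp add: dipole_potential_def dipole_def)

lemma dipole_potential_add:
  assumes "dipole_potential G L x y f" "dipole_potential G L y z g"
  shows "dipole_potential G L x z (\<lambda>v. f v + g v)"
  using assms net_current_linear[of G L f 1 g]
  by (simp add: dipole_potential_def dipole_def)

lemma dipole_potential_minus:
  assumes "dipole_potential G L x y f"
  shows "dipole_potential G L y x (\<lambda>v. - f v)"
  using assms net_current_linear[of G L "\<lambda>_. 0" "-1" f]
  by (simp add: dipole_potential_def dipole_def)

lemma dipole_potential_shift:
  assumes "dipole_potential G L x y f"
  shows "dipole_potential G L x y (\<lambda>v. f v + c)"
  using assms net_current_linear[of G L f 1 "\<lambda>_. c"]
  by (simp add: dipole_potential_def)

lemma energy_commute: "energy G L f g = energy G L g f"
  unfolding energy_def by (rule sum.cong) (auto simp: current_def)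

section \<open>Summation by parts and insertion of an arc\<close>

context fin_digraph
begin

text \<open>As a sum over all arcs, the net current changes by a single term when an arc is removed.
  Self-loops need no special care, since their dipole is 0.\<close>

lemma net_current_alt:
  "net_current G L f v = (\<Sum>a\<in>arcs G. current G L f a * dipole (tail G a) (head G a) v)"
proof -
  have "(\<Sum>a\<in>out_arcs G v. current G L f a) = (\<Sum>a\<in>arcs G. if tail G a = v then current G L f a else 0)"
    "(\<Sum>a\<in>in_arcs G v. current G L f a) = (\<Sum>a\<in>arcs G. if head G a = v then current G L f a else 0)"
    unfolding out_arcs_def in_arcs_def by (simp_all add: sum.inter_filter)
  then show ?thesis
    by (auto simp: net_current_def dipole_def sum_subtractf[symmetric] intro!: sum.cong)
qed

lemma sum_times_dipole:
  assumes "y \<in> verts G" "z \<in> verts G"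
  shows "(\<Sum>v\<in>verts G. g v * dipole y z v) = g y - g z"
proof -
  have "g v * dipole y z v = (if v = y then g v else 0) - (if v = z then g v else 0)" for v
    by (simp add: dipole_def)
  then show ?thesis using assms by (simp add: sum_subtractf)
qed

text \<open>Discrete Green's formula: exchange the sums over vertices and arcs.\<close>

lemma energy_eq_net_current:
  "energy G L f g = (\<Sum>v\<in>verts G. g v * net_current G L f v)"
proof -
  have "(\<Sum>v\<in>verts G. g v * net_current G L f v) =
      (\<Sum>v\<in>verts G. \<Sum>a\<in>arcs G. current G L f a * (g v * dipole (tail G a) (head G a) v))"
    by (simp add: net_current_alt sum_distrib_left algebra_simps)
  also have "\<dots> = (\<Sum>a\<in>arcs G. current G L f a * (\<Sum>v\<in>verts G. g v * dipole (tail G a) (head G a) v))"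
    by (subst sum.swap) (simp add: sum_distrib_left)
  also have "\<dots> = energy G L f g"
    unfolding energy_def by (intro sum.cong refl) (simp add: sum_times_dipole)
  finally show ?thesis ..
qed

lemma energy_dipole_potential:
  assumes "dipole_potential G L y z f" "y \<in> verts G" "z \<in> verts G"
  shows "energy G L f g = g y - g z"
  using assms by (simp add: energy_eq_net_current dipole_potential_def sum_times_dipole)

lemma net_current_del_arc:
  assumes "e \<in> arcs G"
  shows "net_current G L f v =
    net_current (del_arc e) L f v + current G L f e * dipole (tail G e) (head G e) v"
proof -
  interpret D: fin_digraph "del_arc e" by (rule fin_digraph_del_arc)
  show ?thesis
    using assms
    by (simp add: net_current_alt D.net_current_alt current_def sum.remove[of "arcs G" e])
qed

text \<open>The inserted arc draws a current i from its tail to its head, which is compensated by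
  subtracting i times \<open>\<phi>\<close>. The drop across \<open>e\<close> then is d - i R, and
  Ohm's law d - i R = i L gives i = d / (L + R).\<close>

lemma dipole_potential_add_arc:
  assumes "e \<in> arcs G" "L e > 0"
    and \<phi>: "dipole_potential (del_arc e) L (tail G e) (head G e) \<phi>"
    and f: "dipole_potential (del_arc e) L x y f"
    and R: "R = \<phi> (tail G e) - \<phi> (head G e)" "R \<ge> 0"
    and d: "d = f (tail G e) - f (head G e)"
  shows "dipole_potential G L x y (\<lambda>v. f v + (- d / (L e + R)) * \<phi> v)"
proof -
  let ?c = "- d / (L e + R)"
  have "current G L (\<lambda>v. f v + ?c * \<phi> v) e = d / L e + ?c * (R / L e)"
    by (simp only: current_linear) (simp add: current_def R d)
  also have "\<dots> = - ?c"
    using assms(2) R(2) add_pos_nonneg[OF assms(2) R(2)] by (simp add: divide_simps) (simp add: algebra_simps)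
  finally have c: "current G L (\<lambda>v. f v + ?c * \<phi> v) e = - ?c" .
  show ?thesis
    unfolding dipole_potential_def
  proof
    fix v assume "v \<in> verts G"
    then have "net_current (del_arc e) L (\<lambda>v. f v + ?c * \<phi> v) v =
        dipole x y v + ?c * dipole (tail G e) (head G e) v"
      using \<phi> f by (simp only: net_current_linear) (simp add: dipole_potential_def)
    then show "net_current G L (\<lambda>v. f v + ?c * \<phi> v) v = dipole x y v"
      using c by (simp only: net_current_del_arc[OF assms(1)])
  qed
qed

text \<open>When \<open>e\<close> is the only arc between \<open>C\<close> and its complement, the
  whole unit current crosses \<open>e\<close>, and the voltage is constant on each side.\<close>

lemma cut_potential:
  assumes e: "e \<in> arcs G" "L e \<noteq> 0"
    and cut: "\<And>b. b \<in> arcs G \<Longrightarrow> b \<noteq> e \<Longrightarrow> tail G b \<in> C \<longleftrightarrow> head G b \<in> C"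
    and "tail G e \<in> C" "head G e \<notin> C"
  shows "dipole_potential G L (tail G e) (head G e) (\<lambda>v. if v \<in> C then L e else 0)"
    (is "dipole_potential _ _ _ _ ?\<phi>")
proof -
  interpret D: fin_digraph "del_arc e" by (rule fin_digraph_del_arc)
  have "current (del_arc e) L ?\<phi> b = 0" if "b \<in> arcs (del_arc e)" for b
    using cut[of b] that by (simp add: current_def)
  then have "net_current (del_arc e) L ?\<phi> v = 0" for v
    by (simp add: D.net_current_alt)
  moreover have "current G L ?\<phi> e = 1"
    using assms by (simp add: current_def)
  ultimately show ?thesis
    by (simp add: dipole_potential_def net_current_del_arc[OF e(1)])
qed

end

text \<open>Induction on the number of arcs. Only dipoles at the ends of an arc are considered, so
  connectedness, which deletion may destroy, need not be assumed.\<close>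

lemma exists_arc_potential:
  assumes "fin_digraph G" "\<And>a. a \<in> arcs G \<Longrightarrow> L a > 0" "a \<in> arcs G"
  shows "\<exists>f. dipole_potential G L (tail G a) (head G a) f"
  using assms
proof (induction "card (arcs G)" arbitrary: G a)
  case 0
  then show ?case by (auto simp: fin_digraph.finite_arcs)
next
  case (Suc n)
  interpret fin_digraph G by fact
  obtain e where e: "e \<in> arcs G" using Suc.prems(3) by blast
  let ?D = "del_arc e" and ?t = "tail G e" and ?h = "head G e"
  interpret D: fin_digraph ?D by (rule fin_digraph_del_arc)
  have "n = card (arcs ?D)" using Suc.hyps(2) e by simp
  then have IH: "\<exists>f. dipole_potential ?D L (tail G b) (head G b) f" if "b \<in> arcs G" "b \<noteq> e" for b
    using Suc.hyps(1)[of ?D b] Suc.prems(2) that D.fin_digraph_axioms by simp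
  have "\<exists>\<phi>. dipole_potential G L ?t ?h \<phi>"
  proof (cases "\<exists>\<phi>. dipole_potential ?D L ?t ?h \<phi>")
    case True
    then obtain \<phi> where \<phi>: "dipole_potential ?D L ?t ?h \<phi>" by blast
    \<comment> \<open>The drop of \<open>\<phi>\<close> is its energy, hence nonnegative, as the
      insertion of \<open>e\<close> requires.\<close>
    have "energy ?D L \<phi> \<phi> = \<phi> ?t - \<phi> ?h"
      using e by (intro D.energy_dipole_potential[OF \<phi>]) auto
    moreover have "energy ?D L \<phi> \<phi> \<ge> 0"
      unfolding energy_def using Suc.prems(2)
      by (intro sum_nonneg) (auto simp: current_def less_imp_le)
    ultimately show ?thesis
      using dipole_potential_add_arc[of e L \<phi>, OF e _ \<phi> \<phi> refl _ refl] Suc.prems(2) e by auto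
  next
    case False
    \<comment> \<open>By the induction hypothesis no arc other than \<open>e\<close> leaves this
      set. As it contains only one end of \<open>e\<close>, it is a cut.\<close>
    define C where "C = {v. \<exists>f. dipole_potential ?D L ?t v f}"
    have C: "tail G b \<in> C \<longleftrightarrow> head G b \<in> C" if b: "b \<in> arcs G" "b \<noteq> e" for b
      using IH[OF b] unfolding C_def mem_Collect_eq
      by (meson dipole_potential_add dipole_potential_minus)
    have "?t \<in> C" "?h \<notin> C"
      using False dipole_potential_refl[of ?D L ?t] by (auto simp: C_def)
    moreover have "L e \<noteq> 0" using Suc.prems(2)[OF e] by simp
    ultimately show ?thesis using cut_potential[OF e _ C] by blast
  qed
  then obtain \<phi> where \<phi>: "dipole_potential G L ?t ?h \<phi>" by blast
  show ?case
  proof (cases "a = e")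
    case False
    then obtain f where f: "dipole_potential ?D L (tail G a) (head G a) f"
      using IH Suc.prems(3) by blast
    \<comment> \<open>In \<open>G\<close> the function \<open>f\<close> has an excess equal to its
      current through \<open>e\<close> times the dipole of \<open>e\<close>; this multiple of
      \<open>\<phi>\<close> removes it.\<close>
    have "dipole_potential G L (tail G a) (head G a) (\<lambda>v. f v + (- current G L f e) * \<phi> v)"
      unfolding dipole_potential_def
    proof
      fix v assume "v \<in> verts G"
      then show "net_current G L (\<lambda>v. f v + (- current G L f e) * \<phi> v) v =
          dipole (tail G a) (head G a) v"
        using \<phi> f
        by (simp only: net_current_linear) (simp add: dipole_potential_def net_current_del_arc[OF e])
    qed
    then show ?thesis by blast
  qed (use \<phi> in blast)
qed

section \<open>Effective resistance\<close>

context metrized_graph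
begin

text \<open>Adding arc potentials along a walk: the existence of a potential from \<open>x\<close>
  to \<open>v\<close> does not change when \<open>v\<close> moves along an arc.\<close>

lemma exists_dipole_potential:
  assumes "x \<in> verts G" "y \<in> verts G"
  obtains f where "dipole_potential G L x y f"
proof -
  let ?P = "\<lambda>v. \<exists>f. dipole_potential G L x v f"
  have "?P (tail G a) = ?P (head G a)" if a: "a \<in> arcs G" for a
  proof -
    obtain g where g: "dipole_potential G L (tail G a) (head G a) g"
      using exists_arc_potential[of G L, OF fin_digraph_axioms length_pos a] by blast
    show ?thesis
      using dipole_potential_add[OF _ g] dipole_potential_add[OF _ dipole_potential_minus[OF g]]
      by blast
  qed
  then have "?P x = ?P y"
    using assms by (rule connected_constant[OF connected_graph, where P = ?P])
  moreover have "?P x" by (rule exI, rule dipole_potential_refl)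
  ultimately have "?P y" by (rule iffD1)
  then show ?thesis using that by (rule exE)
qed

lemma power_nonneg: "a \<in> arcs G \<Longrightarrow> 0 \<le> current G L f a * (f (tail G a) - f (head G a))"
  using length_pos[of a] by (simp add: current_def)

lemma energy_nonneg: "energy G L f f \<ge> 0"
  unfolding energy_def by (intro sum_nonneg power_nonneg)

lemma zero_energy_imp_constant:
  assumes "energy G L f f = 0" "u \<in> verts G" "v \<in> verts G"
  shows "f u = f v"
proof -
  have "\<forall>a\<in>arcs G. current G L f a * (f (tail G a) - f (head G a)) = 0"
    using assms(1) power_nonneg sum_nonneg_eq_0_iff[OF finite_arcs,
        of "\<lambda>a. current G L f a * (f (tail G a) - f (head G a))"]
    unfolding energy_def by simp
  then have "f (tail G a) = f (head G a)" if "a \<in> arcs G" for a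
    using that length_pos[OF that] by (auto simp: current_def)
  then show ?thesis
    using assms(2,3) by (rule connected_constant[OF connected_graph, where P = f])
qed

text \<open>The difference of two solutions has no net current, so its energy is 0.\<close>

lemma dipole_potential_unique:
  assumes "dipole_potential G L y z f" "dipole_potential G L y z g"
    and "u \<in> verts G" "v \<in> verts G"
  shows "f u - f v = g u - g v"
proof -
  have "net_current G L (\<lambda>v. f v + (-1) * g v) w = 0" if "w \<in> verts G" for w
    using assms(1,2) that by (simp only: net_current_linear) (simp add: dipole_potential_def)
  then have "energy G L (\<lambda>v. f v + (-1) * g v) (\<lambda>v. f v + (-1) * g v) = 0"
    by (simp add: energy_eq_net_current)
  from zero_energy_imp_constant[OF this assms(3,4)] show ?thesis by simp
qed

lemma voltage_eq:
  assumes f: "dipole_potential G L y z f" and "x \<in> verts G" "z \<in> verts G"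
  shows "voltage G L z x y = f x - f z"
  unfolding voltage_def is_voltage_iff
proof (rule the_equality)
  show "\<exists>g. (g z = 0 \<and> dipole_potential G L y z g) \<and> g x = f x - f z"
    using dipole_potential_shift[OF f, of "- f z"] by (intro exI[of _ "\<lambda>v. f v + - f z"]) simp
next
  fix c assume "\<exists>g. (g z = 0 \<and> dipole_potential G L y z g) \<and> g x = c"
  then obtain g where "g z = 0" "dipole_potential G L y z g" "g x = c" by blast
  then show "c = f x - f z"
    using dipole_potential_unique[OF _ f assms(2,3), of g] by simp
qed

lemma eff_res_eq:
  assumes "dipole_potential G L x y f" "x \<in> verts G" "y \<in> verts G"
  shows "eff_res G L x y = f x - f y"
  unfolding eff_res_def using assms by (rule voltage_eq)

lemma eff_res_nonneg:
  assumes "x \<in> verts G" "y \<in> verts G"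
  shows "eff_res G L x y \<ge> 0"
proof -
  obtain f where f: "dipole_potential G L x y f" using exists_dipole_potential assms .
  show ?thesis
    using eff_res_eq[OF f assms] energy_dipole_potential[OF f assms, of f] energy_nonneg[of f] by simp
qed

lemma eff_res_self: "x \<in> verts G \<Longrightarrow> eff_res G L x x = 0"
  using eff_res_eq[OF dipole_potential_refl] by simp

lemma eff_res_commute:
  assumes "x \<in> verts G" "y \<in> verts G"
  shows "eff_res G L x y = eff_res G L y x"
proof -
  obtain f where f: "dipole_potential G L x y f" using exists_dipole_potential assms .
  show ?thesis
    using eff_res_eq[OF f assms] eff_res_eq[OF dipole_potential_minus[OF f] assms(2,1)] by simp
qed

text \<open>Both sides are the energy pairing of \<open>f\<close> and \<open>g\<close>, evaluated in
  its two orders.\<close>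

lemma reciprocity:
  assumes f: "dipole_potential G L x y f" and g: "dipole_potential G L u v g"
    and "x \<in> verts G" "y \<in> verts G" "u \<in> verts G" "v \<in> verts G"
  shows "g x - g y = f u - f v"
  using energy_dipole_potential[OF f assms(3,4), of g] energy_dipole_potential[OF g assms(5,6), of f]
    energy_commute[of G L f g] by simp

text \<open>A potential from \<open>x\<close> to \<open>y\<close> plus one from \<open>y\<close> to
  \<open>p\<close> is one from \<open>x\<close> to \<open>p\<close>; reciprocity eliminates the
  second. The differences that are squared in y thus become linear in one potential.\<close>

lemma eff_res_diff:
  assumes f: "dipole_potential G L x y f" and V: "x \<in> verts G" "y \<in> verts G" "p \<in> verts G"
  shows "eff_res G L x p - eff_res G L y p = f x + f y - 2 * f p"
proof -
  obtain g where g: "dipole_potential G L y p g" using exists_dipole_potential V(2,3) .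
  have "eff_res G L x p = f x + g x - (f p + g p)"
    using eff_res_eq[OF dipole_potential_add[OF f g] V(1,3)] by simp
  moreover have "eff_res G L y p = g y - g p" using eff_res_eq[OF g V(2,3)] .
  moreover have "g x - g y = f y - f p" using reciprocity[OF f g V(1,2,2,3)] .
  ultimately show ?thesis by simp
qed

lemma eff_res_pos:
  assumes "x \<in> verts G" "y \<in> verts G" "x \<noteq> y"
  shows "eff_res G L x y > 0"
proof (rule ccontr)
  obtain f where f: "dipole_potential G L x y f" using exists_dipole_potential assms(1,2) .
  assume "\<not> eff_res G L x y > 0"
  then have "energy G L f f = 0"
    using eff_res_nonneg[OF assms(1,2)] eff_res_eq[OF f assms(1,2)]
      energy_dipole_potential[OF f assms(1,2), of f] by simp
  from zero_energy_imp_constant[OF this]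
  have "f (tail G a) = f (head G a)" if "a \<in> arcs G" for a using that by simp
  then have "net_current G L f x = 0" by (simp add: net_current_alt current_def)
  with f assms show False by (simp add: dipole_potential_def dipole_def)
qed

section \<open>Deletion of an edge, bridges, and the summands of the invariants\<close>

lemma metrized_graph_del_arc:
  assumes "Digraph_Component.connected (del_arc e)"
  shows "metrized_graph (del_arc e) L"
proof -
  interpret D: fin_digraph "del_arc e" by (rule fin_digraph_del_arc)
  show ?thesis by unfold_locales (use assms length_pos in auto)
qed

text \<open>Insert \<open>e\<close> into the potential \<open>f\<close> for \<open>x\<close>,
  \<open>y\<close> on the graph without \<open>e\<close>. By reciprocity the drop of
  \<open>f\<close> across \<open>e\<close> is \<open>\<phi> x - \<phi> y\<close>, so the correction
  becomes a square.\<close>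

lemma eff_res_del_arc:
  assumes e: "e \<in> arcs G" and conn: "Digraph_Component.connected (del_arc e)"
    and \<phi>: "dipole_potential (del_arc e) L (tail G e) (head G e) \<phi>"
    and V: "x \<in> verts G" "y \<in> verts G"
  shows "eff_res G L x y =
    eff_res (del_arc e) L x y - (\<phi> x - \<phi> y)\<^sup>2 / (L e + (\<phi> (tail G e) - \<phi> (head G e)))"
proof -
  interpret D: metrized_graph "del_arc e" L using metrized_graph_del_arc[OF conn] .
  have th: "tail G e \<in> verts (del_arc e)" "head G e \<in> verts (del_arc e)" using e by auto
  have VD: "x \<in> verts (del_arc e)" "y \<in> verts (del_arc e)" using V by auto
  define R where "R = \<phi> (tail G e) - \<phi> (head G e)"
  have R: "R \<ge> 0"
    using D.eff_res_nonneg[OF th] D.eff_res_eq[OF \<phi> th] by (simp add: R_def)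
  obtain f where f: "dipole_potential (del_arc e) L x y f" using D.exists_dipole_potential VD .
  have d: "\<phi> x - \<phi> y = f (tail G e) - f (head G e)"
    using D.reciprocity[OF f \<phi> VD th] .
  have "eff_res G L x y =
      f x + (- (\<phi> x - \<phi> y) / (L e + R)) * \<phi> x - (f y + (- (\<phi> x - \<phi> y) / (L e + R)) * \<phi> y)"
    using eff_res_eq[OF dipole_potential_add_arc[OF e length_pos[OF e] \<phi> f R_def R d] V] by simp
  also have "\<dots> = f x - f y - (\<phi> x - \<phi> y)\<^sup>2 / (L e + R)"
    by (simp add: power2_eq_square diff_divide_distrib add_divide_distrib algebra_simps)
  finally show ?thesis using D.eff_res_eq[OF f VD] by (simp add: R_def)
qed

lemma bridge_eff_res:
  assumes a: "a \<in> arcs G" and "bridge G a" and p: "p \<in> verts G"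
  shows "eff_res G L (tail G a) (head G a) = L a"
    and "(eff_res G L (tail G a) p - eff_res G L (head G a) p)\<^sup>2 = (L a)\<^sup>2"
proof -
  interpret D: fin_digraph "del_arc a" by (rule fin_digraph_del_arc)
  \<comment> \<open>A nonconstant predicate that respects all arcs other than \<open>a\<close>
    describes the cut made by the bridge.\<close>
  have "\<exists>(P :: 'v \<Rightarrow> bool) u v. (\<forall>b\<in>arcs (del_arc a). P (tail (del_arc a) b) = P (head (del_arc a) b)) \<and>
      u \<in> verts (del_arc a) \<and> v \<in> verts (del_arc a) \<and> P u \<noteq> P v"
  proof (rule ccontr)
    assume none: "\<not> ?thesis"
    have "Digraph_Component.connected (del_arc a)"
    proof (rule D.connectedI)
      fix P :: "'v \<Rightarrow> bool" and u v
      assume "\<And>b. b \<in> arcs (del_arc a) \<Longrightarrow> P (tail (del_arc a) b) = P (head (del_arc a) b)"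
        and "u \<in> verts (del_arc a)" "v \<in> verts (del_arc a)"
      then show "P u = P v" using none by metis
    qed (use p in auto)
    then show False using \<open>bridge G a\<close> by (simp add: bridge_def)
  qed
  then obtain P :: "'v \<Rightarrow> bool" and u v
    where P: "\<And>b. b \<in> arcs (del_arc a) \<Longrightarrow> P (tail (del_arc a) b) = P (head (del_arc a) b)"
      and uv: "u \<in> verts (del_arc a)" "v \<in> verts (del_arc a)" "P u \<noteq> P v"
    by blast
  have ne: "P (tail G a) \<noteq> P (head G a)"
  proof
    assume "P (tail G a) = P (head G a)"
    then have "P (tail G b) = P (head G b)" if "b \<in> arcs G" for b
      using P[of b] that by (cases "b = a") auto
    from connected_constant[OF connected_graph, of P u v, OF this] uv show False by auto
  qed
  let ?\<phi> = "\<lambda>v. if v \<in> {v. P v = P (tail G a)} then L a else 0"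
  have \<phi>: "dipole_potential G L (tail G a) (head G a) ?\<phi>"
    by (rule cut_potential) (use a ne P length_pos[OF a] in auto)
  have V: "tail G a \<in> verts G" "head G a \<in> verts G" using a by auto
  show "eff_res G L (tail G a) (head G a) = L a"
    using eff_res_eq[OF \<phi> V] ne by simp
  show "(eff_res G L (tail G a) p - eff_res G L (head G a) p)\<^sup>2 = (L a)\<^sup>2"
    \<comment> \<open>The potential is \<open>L a\<close> on one side and 0 on the other, so the
      difference is \<open>L a\<close> or \<open>- L a\<close> according to the side of
      \<open>p\<close>.\<close>
    using eff_res_diff[OF \<phi> V p] ne by (auto simp: power2_eq_square)
qed

text \<open>For a nonbridge, \<open>a\<close> is in parallel with resistance R, so r = L R / (L +
  R), and the difference of resistances to \<open>p\<close> shrinks by the same factor L / (L + R).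
  A bridge has r = L, which matches the limits.\<close>

lemma edge_term_eff_res:
  assumes a: "a \<in> arcs G" and p: "p \<in> verts G"
  defines "r \<equiv> eff_res G L (tail G a) (head G a)"
    and "D \<equiv> eff_res G L (tail G a) p - eff_res G L (head G a) p"
  shows "edge_term G L p a (\<lambda>R D. (L a)\<^sup>2 * R / (L a + R)\<^sup>2) = r - r\<^sup>2 / L a" (is ?A)
    and "edge_term G L p a (\<lambda>R D. L a * R\<^sup>2 / (L a + R)\<^sup>2) = r\<^sup>2 / L a" (is ?B)
    and "edge_term G L p a (\<lambda>R D. L a * D / (L a + R)\<^sup>2) = D\<^sup>2 / L a" (is ?C)
proof -
  have La: "L a > 0" using length_pos[OF a] .
  have "?A \<and> ?B \<and> ?C"
  proof (cases "bridge G a")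
    case True
    \<comment> \<open>The third kind of summand needs no limit of its own: with D =
      \<open>R\<^sup>2\<close> it coincides with the second.\<close>
    have "((\<lambda>R. (L a)\<^sup>2 * R / (L a + R)\<^sup>2) \<longlongrightarrow> 0) at_top"
      "((\<lambda>R. L a * R\<^sup>2 / (L a + R)\<^sup>2) \<longlongrightarrow> L a) at_top"
      using La by real_asymp+
    then have "Lim at_top (\<lambda>R. (L a)\<^sup>2 * R / (L a + R)\<^sup>2) = 0"
      "Lim at_top (\<lambda>R. L a * R\<^sup>2 / (L a + R)\<^sup>2) = L a"
      by (auto intro!: tendsto_Lim)
    then show ?thesis
      using True La bridge_eff_res[OF a True p]
      by (simp add: edge_term_def r_def D_def power2_eq_square)
  next
    case False
    then have conn: "Digraph_Component.connected (del_arc a)" by (simp add: bridge_def)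
    interpret D: metrized_graph "del_arc a" L using metrized_graph_del_arc[OF conn] .
    have th: "tail G a \<in> verts (del_arc a)" "head G a \<in> verts (del_arc a)"
      "p \<in> verts (del_arc a)" "tail G a \<in> verts G" "head G a \<in> verts G" using a p by auto
    obtain \<phi> where \<phi>: "dipole_potential (del_arc a) L (tail G a) (head G a) \<phi>"
      using D.exists_dipole_potential th(1,2) .
    obtain g where g: "dipole_potential (del_arc a) L p (head G a) g"
      using D.exists_dipole_potential th(3,2) .
    define R where "R = \<phi> (tail G a) - \<phi> (head G a)"
    define s where "s = \<phi> (tail G a) + \<phi> (head G a) - 2 * \<phi> p"
    have edge_R: "edge_R G L a = R"
      unfolding edge_R_def R_def using D.eff_res_eq[OF \<phi> th(1,2)] .
    then have LR: "L a + R > 0"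
      using D.eff_res_nonneg[OF th(1,2)] La by (simp add: edge_R_def)
    have "edge_Ra G L p a = \<phi> (tail G a) - \<phi> p"
      unfolding edge_Ra_def using D.voltage_eq[OF dipole_potential_minus[OF \<phi>] th(3,1)] by simp
    \<comment> \<open>Here the current enters at \<open>p\<close>, not at an end of
      \<open>a\<close>; reciprocity turns this voltage into a drop of \<open>\<phi>\<close>.\<close>
    moreover have "edge_Rb G L p a = \<phi> p - \<phi> (head G a)"
      unfolding edge_Rb_def
      using D.voltage_eq[OF g th(1,2)] D.reciprocity[OF \<phi> g th(1,2,3,2)] by simp
    ultimately have s: "edge_Ra G L p a - edge_Rb G L p a = s" by (simp add: s_def)
    have r: "r = L a * R / (L a + R)"
      using eff_res_del_arc[OF a conn \<phi> th(4,5)] D.eff_res_eq[OF \<phi> th(1,2)] LR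
      unfolding r_def R_def[symmetric] by (simp add: field_simps power2_eq_square)
    have "D = s - ((\<phi> (tail G a) - \<phi> p)\<^sup>2 - (\<phi> (head G a) - \<phi> p)\<^sup>2) / (L a + R)"
      using eff_res_del_arc[OF a conn \<phi> th(4) p] eff_res_del_arc[OF a conn \<phi> th(5) p]
        D.eff_res_diff[OF \<phi> th(1-3)]
      unfolding D_def R_def[symmetric] s_def by (simp add: diff_divide_distrib)
    also have "(\<phi> (tail G a) - \<phi> p)\<^sup>2 - (\<phi> (head G a) - \<phi> p)\<^sup>2 = R * s"
      unfolding R_def s_def by (simp add: power2_eq_square algebra_simps)
    finally have D: "D = L a * s / (L a + R)"
      using LR by (simp add: field_simps)
    have "(L a)\<^sup>2 * R / (L a + R)\<^sup>2 = r - r\<^sup>2 / L a"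
      using LR La unfolding r by (simp add: divide_simps power2_eq_square) (simp add: algebra_simps)
    moreover have "L a * R\<^sup>2 / (L a + R)\<^sup>2 = r\<^sup>2 / L a" "L a * s\<^sup>2 / (L a + R)\<^sup>2 = D\<^sup>2 / L a"
      using LR La unfolding r D by (simp_all add: power2_eq_square)
    ultimately show ?thesis
      using False by (simp add: edge_term_def edge_R s)
  qed
  then show ?A ?B ?C by blast+
qed

section \<open>The invariants through effective resistances, and independence of the base
  point\<close>

lemma y_inv_eff_res:
  assumes "p \<in> verts G"
  shows "y_inv G L p = (\<Sum>a\<in>arcs G. ((eff_res G L (tail G a) (head G a))\<^sup>2 +
    3 * (eff_res G L (tail G a) p - eff_res G L (head G a) p)\<^sup>2) / (4 * L a))"
proof -
  have "y_inv G L p =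
      1/4 * (\<Sum>a\<in>arcs G. (eff_res G L (tail G a) (head G a))\<^sup>2 / L a) +
      3/4 * (\<Sum>a\<in>arcs G. (eff_res G L (tail G a) p - eff_res G L (head G a) p)\<^sup>2 / L a)"
    unfolding y_inv_def
    by (intro arg_cong2[of _ _ _ _ "(+)"] arg_cong2[of _ _ _ _ "(*)"] sum.cong refl)
      (simp_all only: edge_term_eff_res[OF _ assms])
  also have "\<dots> = (\<Sum>a\<in>arcs G. ((eff_res G L (tail G a) (head G a))\<^sup>2 +
    3 * (eff_res G L (tail G a) p - eff_res G L (head G a) p)\<^sup>2) / (4 * L a))"
    unfolding sum_distrib_left sum.distrib[symmetric]
    by (intro sum.cong refl) (simp add: add_divide_distrib)
  finally show ?thesis .
qed

text \<open>The first two kinds of summand add up to r, and the coefficients 3/4 and -3/4 in x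
  become -1/4 and -3/4, those of -y, once r is split off.\<close>

lemma x_inv_eff_res:
  assumes "p \<in> verts G"
  shows "x_inv G L p = (\<Sum>a\<in>arcs G. eff_res G L (tail G a) (head G a)) - y_inv G L p"
proof -
  have "(\<Sum>a\<in>arcs G. edge_term G L p a (\<lambda>R D. (L a)\<^sup>2 * R / (L a + R)\<^sup>2)) =
      (\<Sum>a\<in>arcs G. eff_res G L (tail G a) (head G a)) -
      (\<Sum>a\<in>arcs G. edge_term G L p a (\<lambda>R D. L a * R\<^sup>2 / (L a + R)\<^sup>2))"
    unfolding sum_subtractf[symmetric]
    by (intro sum.cong refl) (simp only: edge_term_eff_res[OF _ assms])
  then show ?thesis unfolding x_inv_def y_inv_def by simp
qed

text \<open>
  As functions of the vertex, the effective resistances to \<open>p\<close> and to \<open>q\<close> differ by a constant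
  minus twice a dipole potential \<open>f\<close>, so the difference of their energies is the pairing of \<open>f\<close>
  with a function that takes the same value \<open>r(p, q)\<close> at both \<open>p\<close> and \<open>q\<close>.
\<close>

lemma y_inv_base_point:
  assumes p: "p \<in> verts G" and q: "q \<in> verts G"
  shows "y_inv G L p = y_inv G L q"
proof -
  define D where "D p a = eff_res G L (tail G a) p - eff_res G L (head G a) p" for p a
  obtain f where f: "dipole_potential G L p q f" using exists_dipole_potential p q .
  define \<rho> where "\<rho> v = eff_res G L v p + eff_res G L v q" for v
  have D: "D p a - D q a = - 2 * (f (tail G a) - f (head G a))" if a: "a \<in> arcs G" for a
  proof -
    have V: "tail G a \<in> verts G" "head G a \<in> verts G" using a by auto
    obtain \<phi> where \<phi>: "dipole_potential G L (tail G a) (head G a) \<phi>"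
      using exists_dipole_potential V .
    show ?thesis
      using eff_res_diff[OF \<phi> V p] eff_res_diff[OF \<phi> V q] reciprocity[OF f \<phi> p q V]
      by (simp add: D_def)
  qed
  have "(\<Sum>a\<in>arcs G. (D p a)\<^sup>2 / L a) - (\<Sum>a\<in>arcs G. (D q a)\<^sup>2 / L a) = - 2 * energy G L f \<rho>"
    unfolding energy_def sum_subtractf[symmetric] sum_distrib_left
  proof (intro sum.cong refl)
    fix a assume a: "a \<in> arcs G"
    have "(D p a)\<^sup>2 / L a - (D q a)\<^sup>2 / L a = (D p a - D q a) * (D p a + D q a) / L a"
      by (simp add: power2_eq_square algebra_simps diff_divide_distrib)
    also have "D p a + D q a = \<rho> (tail G a) - \<rho> (head G a)"
      by (simp add: D_def \<rho>_def)
    finally show "(D p a)\<^sup>2 / L a - (D q a)\<^sup>2 / L a =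
        - 2 * (current G L f a * (\<rho> (tail G a) - \<rho> (head G a)))"
      by (simp only: D[OF a] current_def times_divide_eq_left times_divide_eq_right mult.assoc)
  qed
  also have "energy G L f \<rho> = 0"
    using energy_dipole_potential[OF f p q, of \<rho>] eff_res_commute[OF p q]
    by (simp add: \<rho>_def eff_res_self p q)
  finally have "(\<Sum>a\<in>arcs G. (D p a)\<^sup>2 / L a) = (\<Sum>a\<in>arcs G. (D q a)\<^sup>2 / L a)" by simp
  moreover have "y_inv G L p = (\<Sum>a\<in>arcs G. (eff_res G L (tail G a) (head G a))\<^sup>2 / (4 * L a)) +
      3/4 * (\<Sum>a\<in>arcs G. (D p a)\<^sup>2 / L a)" if "p \<in> verts G" for p
    unfolding y_inv_eff_res[OF that] D_def sum_distrib_left sum.distrib[symmetric]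
    by (simp add: add_divide_distrib)
  ultimately show ?thesis using p q by simp
qed

lemma x_inv_base_point:
  assumes "p \<in> verts G" "q \<in> verts G"
  shows "x_inv G L p = x_inv G L q"
  using assms y_inv_base_point[OF assms] by (simp add: x_inv_eff_res)

end

section \<open>Contraction\<close>

text \<open>The projection bound by \<open>let\<close> in \<open>contract_edge\<close>, as a
  function of its own.\<close>

definition merge_ends :: "('v, 'e) pre_digraph \<Rightarrow> 'e \<Rightarrow> 'v \<Rightarrow> 'v" where
  "merge_ends G e v = (if v = head G e then tail G e else v)"

lemma contract_edge_simps [simp]:
  "verts (contract_edge G e) = merge_ends G e ` verts G"
  "arcs (contract_edge G e) = arcs G - {e}"
  "tail (contract_edge G e) a = merge_ends G e (tail G a)"
  "head (contract_edge G e) a = merge_ends G e (head G a)"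
  by (auto simp: contract_edge_def merge_ends_def Let_def)

lemma (in fin_digraph) fin_digraph_contract_edge: "fin_digraph (contract_edge G e)"
  by unfold_locales auto

text \<open>A function equal at both ends of \<open>e\<close> descends unchanged to the contraction,
  where the net currents at the two ends add up.\<close>

lemma (in fin_digraph) net_current_contract:
  assumes f: "f (tail G e) = f (head G e)" and ne: "tail G e \<noteq> head G e" and "v \<noteq> head G e"
  shows "net_current (contract_edge G e) L f v =
    (if v = tail G e then net_current (del_arc e) L f (tail G e) + net_current (del_arc e) L f (head G e)
     else net_current (del_arc e) L f v)"
proof -
  interpret C: fin_digraph "contract_edge G e" by (rule fin_digraph_contract_edge)
  interpret D: fin_digraph "del_arc e" by (rule fin_digraph_del_arc)
  have "f (merge_ends G e u) = f u" for u using f by (simp add: merge_ends_def)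
  then have cur: "current (contract_edge G e) L f a = current (del_arc e) L f a" for a
    by (simp add: current_def)
  have "dipole (merge_ends G e x) (merge_ends G e y) v =
      (if v = tail G e then dipole x y (tail G e) + dipole x y (head G e) else dipole x y v)" for x y
    using assms(2,3) by (auto simp: dipole_def merge_ends_def)
  then show ?thesis
    by (simp add: C.net_current_alt D.net_current_alt cur sum.distrib[symmetric] algebra_simps)
qed

section \<open>Resistances after contraction and the deletion-contraction formulas\<close>

context metrized_graph
begin

lemma metrized_graph_contract_edge: "metrized_graph (contract_edge G e) L"
proof -
  interpret C: fin_digraph "contract_edge G e" by (rule fin_digraph_contract_edge)
  have "Digraph_Component.connected (contract_edge G e)"
  proof (rule C.connectedI)
    show "verts (contract_edge G e) \<noteq> {}"
      using connected_graph by (simp add: connected_conv)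
  next
    fix P :: "'v \<Rightarrow> bool" and u v
    assume P: "\<And>a. a \<in> arcs (contract_edge G e) \<Longrightarrow>
        P (tail (contract_edge G e) a) = P (head (contract_edge G e) a)"
      and uv: "u \<in> verts (contract_edge G e)" "v \<in> verts (contract_edge G e)"
    let ?P = "\<lambda>w. P (merge_ends G e w)"
    have *: "?P (tail G a) = ?P (head G a)" if "a \<in> arcs G" for a
      using P[of a] that by (cases "a = e") (auto simp: merge_ends_def)
    obtain u' v' where "u' \<in> verts G" "v' \<in> verts G" "u = merge_ends G e u'" "v = merge_ends G e v'"
      using uv by auto
    with connected_constant[OF connected_graph, where P = ?P, OF *, of u' v']
    show "P u = P v" by simp
  qed
  then show ?thesis by unfold_locales (auto simp: length_pos)
qed

text \<open>The case of an inserted edge of length 0: a multiple of \<open>\<phi>\<close> is added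
  to \<open>f\<close> until the ends of \<open>e\<close> have equal voltage. The extra dipole this
  creates vanishes when the ends are merged.\<close>

lemma eff_res_contract_edge:
  assumes e: "e \<in> arcs G" and ne: "tail G e \<noteq> head G e"
    and conn: "Digraph_Component.connected (del_arc e)"
    and \<phi>: "dipole_potential (del_arc e) L (tail G e) (head G e) \<phi>"
    and V: "x \<in> verts G" "y \<in> verts G"
  shows "eff_res (contract_edge G e) L (merge_ends G e x) (merge_ends G e y) =
    eff_res (del_arc e) L x y - (\<phi> x - \<phi> y)\<^sup>2 / (\<phi> (tail G e) - \<phi> (head G e))"
proof -
  interpret D: metrized_graph "del_arc e" L using metrized_graph_del_arc[OF conn] .
  interpret C: metrized_graph "contract_edge G e" L by (rule metrized_graph_contract_edge)
  have th: "tail G e \<in> verts (del_arc e)" "head G e \<in> verts (del_arc e)" using e by auto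
  have VD: "x \<in> verts (del_arc e)" "y \<in> verts (del_arc e)" using V by auto
  have VC: "merge_ends G e x \<in> verts (contract_edge G e)" "merge_ends G e y \<in> verts (contract_edge G e)"
    using V by auto
  define R where "R = \<phi> (tail G e) - \<phi> (head G e)"
  have R: "R > 0"
    using D.eff_res_pos[OF th ne] D.eff_res_eq[OF \<phi> th] by (simp add: R_def)
  obtain f where f: "dipole_potential (del_arc e) L x y f" using D.exists_dipole_potential VD .
  define c where "c = - (\<phi> x - \<phi> y) / R"
  define g where "g v = f v + c * \<phi> v" for v
  have "g (tail G e) - g (head G e) = f (tail G e) - f (head G e) + c * R"
    by (simp add: g_def R_def algebra_simps)
  then have g_eq: "g (tail G e) = g (head G e)"
    using D.reciprocity[OF f \<phi> VD th] R by (simp add: c_def)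
  then have g_merge: "g (merge_ends G e v) = g v" for v by (simp add: merge_ends_def)
  have gD: "net_current (del_arc e) L g v = dipole x y v + c * dipole (tail G e) (head G e) v"
    if "v \<in> verts G" for v
    using f \<phi> that unfolding g_def net_current_linear by (simp add: dipole_potential_def)
  have "dipole_potential (contract_edge G e) L (merge_ends G e x) (merge_ends G e y) g"
    unfolding dipole_potential_def
  proof
    fix v assume "v \<in> verts (contract_edge G e)"
    then have v: "v \<noteq> head G e" "v \<in> verts G"
      using ne e by (auto simp: merge_ends_def split: if_splits)
    show "net_current (contract_edge G e) L g v = dipole (merge_ends G e x) (merge_ends G e y) v"
      unfolding net_current_contract[OF g_eq ne v(1)]
      using gD[OF v(2)] gD[of "tail G e"] gD[of "head G e"] e ne v(1)
      by (auto simp: dipole_def merge_ends_def)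
  qed
  from C.eff_res_eq[OF this VC]
  have "eff_res (contract_edge G e) L (merge_ends G e x) (merge_ends G e y) = g x - g y"
    by (simp add: g_merge)
  also have "\<dots> = f x - f y - (\<phi> x - \<phi> y)\<^sup>2 / R"
    by (simp add: g_def c_def power2_eq_square diff_divide_distrib add_divide_distrib algebra_simps)
  finally show ?thesis using D.eff_res_eq[OF f VD] by (simp add: R_def)
qed

text \<open>A loop carries no current: \<open>\<phi>\<close> can be taken as 0, so no resistance
  changes, and the loop's own summand is 0.\<close>

lemma loop_delete:
  assumes e: "e \<in> arcs G" and loop: "tail G e = head G e"
    and conn: "Digraph_Component.connected (del_arc e)" and p: "p \<in> verts G"
  shows "edge_R G L e = 0" "x_inv G L p = x_inv (del_arc e) L p"
    "y_inv G L p = y_inv (del_arc e) L p"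
proof -
  interpret D: metrized_graph "del_arc e" L using metrized_graph_del_arc[OF conn] .
  have pD: "p \<in> verts (del_arc e)" using p by simp
  show "edge_R G L e = 0"
    using e loop by (simp add: edge_R_def D.eff_res_self)
  have r: "eff_res G L x y = eff_res (del_arc e) L x y" if "x \<in> verts G" "y \<in> verts G" for x y
    using eff_res_del_arc[OF e conn _ that, of "\<lambda>_. 0"] dipole_potential_refl[of "del_arc e" L "head G e"] loop
    by simp
  have r0: "eff_res (del_arc e) L (head G e) (head G e) = 0"
    using e by (simp add: D.eff_res_self)
  show y: "y_inv G L p = y_inv (del_arc e) L p"
    unfolding y_inv_eff_res[OF p] D.y_inv_eff_res[OF pD]
    using e p by (simp add: sum.remove[OF _ e] r r0 loop)
  show "x_inv G L p = x_inv (del_arc e) L p"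
    unfolding x_inv_eff_res[OF p] D.x_inv_eff_res[OF pD] y
    using e p by (simp add: sum.remove[OF _ e] r r0 loop)
qed

lemma deletion_contraction:
  assumes e: "e \<in> arcs G" and ne: "tail G e \<noteq> head G e"
    and conn: "Digraph_Component.connected (del_arc e)"
  defines "R \<equiv> edge_R G L e" and "p \<equiv> tail G e"
  shows "y_inv G L p =
      L e / (L e + R) * y_inv (del_arc e) L p + R / (L e + R) * y_inv (contract_edge G e) L p"
      (is ?y)
    and "x_inv G L p = L e * R / (L e + R) +
      L e / (L e + R) * x_inv (del_arc e) L p + R / (L e + R) * x_inv (contract_edge G e) L p"
      (is ?x)
proof -
  interpret D: metrized_graph "del_arc e" L using metrized_graph_del_arc[OF conn] .
  interpret C: metrized_graph "contract_edge G e" L by (rule metrized_graph_contract_edge)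
  define h where "h = head G e"
  have V: "p \<in> verts G" "h \<in> verts G" using e by (auto simp: p_def h_def)
  then have VD: "p \<in> verts (del_arc e)" "h \<in> verts (del_arc e)" by auto
  have pm: "merge_ends G e p = p" by (simp add: merge_ends_def p_def)
  then have VC: "p \<in> verts (contract_edge G e)" using V(1) by (auto intro: image_eqI[of _ _ p])
  obtain \<phi>' where "dipole_potential (del_arc e) L p h \<phi>'"
    using D.exists_dipole_potential VD .
  \<comment> \<open>With \<open>\<phi>\<close> zero at the base point, resistances to
    \<open>p\<close> are corrected by multiples of \<open>\<phi>\<^sup>2\<close>.\<close>
  from dipole_potential_shift[OF this, of "- \<phi>' p"]
  obtain \<phi> where \<phi>: "dipole_potential (del_arc e) L p h \<phi>" and \<phi>p: "\<phi> p = 0" by fastforce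
  have R: "R = - \<phi> h"
    using D.eff_res_eq[OF \<phi> VD] by (simp add: R_def edge_R_def p_def[symmetric] h_def[symmetric] \<phi>p)
  have Rpos: "R > 0"
    using D.eff_res_pos[OF VD] ne unfolding R_def edge_R_def p_def h_def .
  have Le: "L e > 0" using length_pos[OF e] .
  define \<alpha> \<beta> where "\<alpha> = L e / (L e + R)" and "\<beta> = R / (L e + R)"
  define rG rD rC where "rG x y = eff_res G L x y" and "rD x y = eff_res (del_arc e) L x y"
    and "rC x y = eff_res (contract_edge G e) L (merge_ends G e x) (merge_ends G e y)" for x y
  have rG: "rG x y = rD x y - (\<phi> x - \<phi> y)\<^sup>2 / (L e + R)"
    and rC: "rC x y = rD x y - (\<phi> x - \<phi> y)\<^sup>2 / R" if "x \<in> verts G" "y \<in> verts G" for x y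
    using eff_res_del_arc[OF e conn _ that] eff_res_contract_edge[OF e ne conn _ that] \<phi>
    unfolding rG_def rD_def rC_def p_def h_def by (simp_all add: R h_def \<phi>p[unfolded p_def])
  have nz: "L e + R \<noteq> 0" "R \<noteq> 0" using Le Rpos by auto
  have mix1: "\<alpha> * a + \<beta> * (a - u / R) = a - u / (L e + R)" for a u
    using nz unfolding \<alpha>_def \<beta>_def
    by (simp add: divide_simps) (simp add: algebra_simps)
  \<comment> \<open>The variance of a variable that is 0 with weight \<open>\<alpha>\<close> and 1/R
    with weight \<open>\<beta>\<close>; its mean is 1 / (L + R).\<close>
  define K where "K = L e / (R * (L e + R)\<^sup>2)"
  have mix2: "\<alpha> * a\<^sup>2 + \<beta> * (a - u / R)\<^sup>2 = (a - u / (L e + R))\<^sup>2 + K * u\<^sup>2" for a u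
    using nz unfolding \<alpha>_def \<beta>_def K_def
    by (simp add: divide_simps power2_eq_square) (simp add: algebra_simps)
  \<comment> \<open>The summand of y for a variable resistance function, so that the three graphs
    can be compared arc by arc.\<close>
  define Q where "Q r a = ((r (tail G a) (head G a))\<^sup>2 + 3 * (r (tail G a) p - r (head G a) p)\<^sup>2) / (4 * L a)"
    for r :: "'v \<Rightarrow> 'v \<Rightarrow> real" and a
  have Q: "\<alpha> * Q rD a + \<beta> * Q rC a = Q rG a +
      K * (current (del_arc e) L \<phi> a * ((\<phi> (tail G a))^3 - (\<phi> (head G a))^3))"
    if a: "a \<in> arcs G" for a
  proof -
    have Va: "tail G a \<in> verts G" "head G a \<in> verts G" using a by auto
    define s t where "s = \<phi> (tail G a)" and "t = \<phi> (head G a)"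
    define A B where "A = rD (tail G a) (head G a)" and "B = rD (tail G a) p - rD (head G a) p"
    have 1: "rG (tail G a) (head G a) = A - (s - t)\<^sup>2 / (L e + R)"
      "rC (tail G a) (head G a) = A - (s - t)\<^sup>2 / R"
      "rG (tail G a) p - rG (head G a) p = B - (s\<^sup>2 - t\<^sup>2) / (L e + R)"
      "rC (tail G a) p - rC (head G a) p = B - (s\<^sup>2 - t\<^sup>2) / R"
      using Va V by (simp_all add: rG rC A_def B_def s_def t_def \<phi>p diff_divide_distrib)
    have "\<alpha> * Q rD a + \<beta> * Q rC a =
        ((\<alpha> * A\<^sup>2 + \<beta> * (A - (s - t)\<^sup>2 / R)\<^sup>2) + 3 * (\<alpha> * B\<^sup>2 + \<beta> * (B - (s\<^sup>2 - t\<^sup>2) / R)\<^sup>2)) / (4 * L a)"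
      unfolding Q_def 1 A_def[symmetric] B_def[symmetric]
      by (simp add: add_divide_distrib ring_distribs)
    also have "\<dots> = Q rG a + K * ((((s - t)\<^sup>2)\<^sup>2 + 3 * (s\<^sup>2 - t\<^sup>2)\<^sup>2) / (4 * L a))"
      unfolding mix2 Q_def 1 by (simp add: add_divide_distrib ring_distribs)
    \<comment> \<open>The weights 1 and 3 in y are what turns the two squares into a product of the
      drops of \<open>\<phi>\<close> and \<open>\<phi>\<^sup>3\<close>.\<close>
    also have "((s - t)\<^sup>2)\<^sup>2 + 3 * (s\<^sup>2 - t\<^sup>2)\<^sup>2 = 4 * ((s - t) * (s^3 - t^3))"
      by algebra
    finally show ?thesis by (simp add: current_def s_def t_def)
  qed
  have "(\<Sum>a\<in>arcs G - {e}. current (del_arc e) L \<phi> a * ((\<phi> (tail G a))^3 - (\<phi> (head G a))^3)) = R^3"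
    using D.energy_dipole_potential[OF \<phi> VD, of "\<lambda>v. (\<phi> v)^3"] by (simp add: energy_def R \<phi>p)
  then have Qsum: "\<alpha> * (\<Sum>a\<in>arcs G - {e}. Q rD a) + \<beta> * (\<Sum>a\<in>arcs G - {e}. Q rC a) =
      (\<Sum>a\<in>arcs G - {e}. Q rG a) + K * R^3"
    unfolding sum_distrib_left sum.distrib[symmetric]
    by (simp add: Q sum.distrib sum_distrib_left[symmetric])
  have rGe: "rG p h = L e * R / (L e + R)"
  proof -
    have "rD p h = R" by (simp add: rD_def R_def edge_R_def p_def h_def)
    moreover have "(\<phi> p - \<phi> h)\<^sup>2 = R\<^sup>2" by (simp add: R \<phi>p)
    ultimately have "rG p h = R - R\<^sup>2 / (L e + R)" by (simp only: rG[OF V])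
    then show ?thesis
      using nz by (simp add: divide_simps power2_eq_square) (simp add: algebra_simps)
  qed
  \<comment> \<open>As \<open>p\<close> is an end of \<open>e\<close>, both squares in this summand
    are the square of \<open>rG p h\<close>.\<close>
  have Qe: "Q rG e = K * R^3"
  proof -
    have "rG p p = 0" "rG h p = rG p h"
      using eff_res_self eff_res_commute V by (simp_all add: rG_def)
    then have "Q rG e = (rG p h)\<^sup>2 / L e"
      using p_def h_def by (simp add: Q_def)
    then show ?thesis
      unfolding rGe K_def using Le Rpos by (simp add: power2_eq_square power3_eq_cube)
  qed
  have yG: "y_inv G L p = Q rG e + (\<Sum>a\<in>arcs G - {e}. Q rG a)"
    unfolding y_inv_eff_res[OF V(1)] Q_def rG_def by (rule sum.remove[OF finite_arcs e])
  have yD: "y_inv (del_arc e) L p = (\<Sum>a\<in>arcs G - {e}. Q rD a)"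
    unfolding D.y_inv_eff_res[OF VD(1)] Q_def rD_def by simp
  have yC: "y_inv (contract_edge G e) L p = (\<Sum>a\<in>arcs G - {e}. Q rC a)"
    unfolding C.y_inv_eff_res[OF VC] Q_def rC_def by (simp add: pm)
  have y: "y_inv G L p = \<alpha> * y_inv (del_arc e) L p + \<beta> * y_inv (contract_edge G e) L p"
    unfolding yG yD yC Qsum Qe by simp
  then show ?y unfolding \<alpha>_def \<beta>_def .
  have "\<alpha> * rD (tail G a) (head G a) + \<beta> * rC (tail G a) (head G a) = rG (tail G a) (head G a)"
    if "a \<in> arcs G" for a
    using that by (simp add: rG rC mix1)
  \<comment> \<open>Resistances mix linearly, without variance. The resistance between the ends of
    \<open>e\<close> is left over and is the additional term in x.\<close>
  then have S: "\<alpha> * (\<Sum>a\<in>arcs G - {e}. rD (tail G a) (head G a)) +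
      \<beta> * (\<Sum>a\<in>arcs G - {e}. rC (tail G a) (head G a)) =
      (\<Sum>a\<in>arcs G - {e}. rG (tail G a) (head G a))"
    unfolding sum_distrib_left sum.distrib[symmetric] by simp
  have xG: "x_inv G L p = rG p h + (\<Sum>a\<in>arcs G - {e}. rG (tail G a) (head G a)) - y_inv G L p"
    using x_inv_eff_res[OF V(1)]
      sum.remove[OF finite_arcs e, of "\<lambda>a. eff_res G L (tail G a) (head G a)"]
    by (simp add: rG_def p_def h_def)
  have xD: "x_inv (del_arc e) L p = (\<Sum>a\<in>arcs G - {e}. rD (tail G a) (head G a)) - y_inv (del_arc e) L p"
    unfolding D.x_inv_eff_res[OF VD(1)] rD_def by simp
  have xC: "x_inv (contract_edge G e) L p =
      (\<Sum>a\<in>arcs G - {e}. rC (tail G a) (head G a)) - y_inv (contract_edge G e) L p"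
    unfolding C.x_inv_eff_res[OF VC] rC_def by simp
  have "x_inv G L p = L e * R / (L e + R) +
      \<alpha> * x_inv (del_arc e) L p + \<beta> * x_inv (contract_edge G e) L p"
    unfolding xG xD xC y rGe S[symmetric] by (simp add: algebra_simps)
  then show ?x unfolding \<alpha>_def \<beta>_def .
qed

end

theorem theorem4p11:
  fixes \<Gamma> :: "('v, 'e) pre_digraph" and L :: "'e \<Rightarrow> real" and e :: 'e and p p' p'' :: 'v
  assumes "metrized_graph \<Gamma> L"
    and "e \<in> arcs \<Gamma>"
    and "Digraph_Component.connected (delete_edge \<Gamma> e)"
    and "p \<in> verts \<Gamma>"
    and "p' \<in> verts (delete_edge \<Gamma> e)"
    and "p'' \<in> verts (contract_edge \<Gamma> e)"
  shows "x_inv \<Gamma> L p =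
           L e * edge_R \<Gamma> L e / (L e + edge_R \<Gamma> L e)
         + L e / (L e + edge_R \<Gamma> L e) * x_inv (delete_edge \<Gamma> e) L p'
         + edge_R \<Gamma> L e / (L e + edge_R \<Gamma> L e) * x_inv (contract_edge \<Gamma> e) L p''
       \<and> y_inv \<Gamma> L p =
           L e / (L e + edge_R \<Gamma> L e) * y_inv (delete_edge \<Gamma> e) L p'
         + edge_R \<Gamma> L e / (L e + edge_R \<Gamma> L e) * y_inv (contract_edge \<Gamma> e) L p''"
proof -
  interpret metrized_graph \<Gamma> L by fact
  interpret D: metrized_graph "delete_edge \<Gamma> e" L using metrized_graph_del_arc[OF assms(3)] .
  interpret C: metrized_graph "contract_edge \<Gamma> e" L by (rule metrized_graph_contract_edge)
  \<comment> \<open>A vertex of all three graphs, to which every base point is moved.\<close>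
  let ?t = "tail \<Gamma> e"
  have t: "?t \<in> verts \<Gamma>" using assms(2) by simp
  then have tD: "?t \<in> verts (delete_edge \<Gamma> e)" by simp
  have tC: "?t \<in> verts (contract_edge \<Gamma> e)"
    using t by (auto simp: merge_ends_def intro: image_eqI[of _ _ ?t])
  note base = x_inv_base_point[OF assms(4) t] y_inv_base_point[OF assms(4) t]
    D.x_inv_base_point[OF assms(5) tD] D.y_inv_base_point[OF assms(5) tD]
    C.x_inv_base_point[OF assms(6) tC] C.y_inv_base_point[OF assms(6) tC]
  show ?thesis
  proof (cases "?t = head \<Gamma> e")
    \<comment> \<open>For a loop R is 0, so deletion has weight 1 and contraction weight 0.\<close>
    case True
    show ?thesis
      unfolding base loop_delete[OF assms(2) True assms(3) t]
      using length_pos[OF assms(2)] by simp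
  next
    case False
    show ?thesis
      unfolding base using deletion_contraction[OF assms(2) False assms(3)] by blast
  qed
qed

end
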